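(* For every non-decreasing function $F:\mathbb{R}_+^*\rightarrow\,]0,1]$, there exists a compact measured metric space $(S,d,\mu)$ such that, for $\xi_1,\xi_2$ independent random variables with distribution $\mu$ and $D=d(\xi_1,\xi_2)$, one has $\mathbb{P}(D\leq\varepsilon)\leq F(\varepsilon)$ for all sufficiently small $\varepsilon>0$.
   Context: Notation: $\mathbb{R}_+^*=\,]0,\infty[$ and $]0,1]$ is the half-open interval excluding $0$. A compact measured metric space is a compact metric space $(S,d)$ endowed with a Borel probability measure $\mu$ on $S$. *)

theory Defs
  imports "HOL-Probability.Probability"
begin

locale compact_measured_metric_space =
  Metric_space S d + prob_space \<mu>
  for S :: "'a set" and d :: "'a \<Rightarrow> 'a \<Rightarrow> real" and \<mu> :: "'a measure" +
  assumes compact: "compact_space mtopology"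
    and space_eq: "space \<mu> = S"
    and sets_eq: "sets \<mu> = sigma_sets S {U. openin mtopology U}"
begin

lemma mball_sets: "mball x r \<in> sets \<mu>"
  unfolding sets_eq by (rule sigma_sets.Basic) simp

text \<open>Compact metric spaces are separable, so the distance is measurable with respect to the
  product of the Borel sigma-algebras, and events such as \<open>D \<le> \<epsilon>\<close> really are measurable.\<close>

lemma countable_dense_centers:
  obtains C where "countable C" "C \<subseteq> S" "\<And>x e. x \<in> S \<Longrightarrow> e > 0 \<Longrightarrow> \<exists>c\<in>C. d c x < e"
proof -
  have tb: "mtotally_bounded S"
    using compact compact_space_eq_mcomplete_mtotally_bounded by blast
  have "\<forall>n::nat. \<exists>K. finite K \<and> K \<subseteq> S \<and> S \<subseteq> (\<Union>x\<in>K. mball x (1 / Suc n))"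
    using tb unfolding mtotally_bounded_def by simp
  then obtain K where K: "\<And>n::nat. finite (K n) \<and> K n \<subseteq> S \<and> S \<subseteq> (\<Union>x\<in>K n. mball x (1 / Suc n))"
    by metis
  show thesis
  proof (rule that[of "\<Union>n. K n"])
    show "countable (\<Union>n. K n)" using K by (simp add: countable_finite)
    show "(\<Union>n. K n) \<subseteq> S" using K by blast
    fix x and e :: real assume "x \<in> S" "e > 0"
    then obtain n where n: "1 / Suc n < e" by (metis inverse_eq_divide reals_Archimedean)
    from K \<open>x \<in> S\<close> obtain c where "c \<in> K n" "x \<in> mball c (1 / Suc n)" by blast
    then show "\<exists>c\<in>\<Union>n. K n. d c x < e" using n by (intro bexI[of _ c]) auto
  qed
qed

lemma measurable_dist: "(\<lambda>p. d (fst p) (snd p)) \<in> borel_measurable (\<mu> \<Otimes>\<^sub>M \<mu>)"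
proof -
  obtain C where C: "countable C" "C \<subseteq> S"
    and dense: "\<And>x e. x \<in> S \<Longrightarrow> e > 0 \<Longrightarrow> \<exists>c\<in>C. d c x < e"
    using countable_dense_centers by blast
  have "{p \<in> space (\<mu> \<Otimes>\<^sub>M \<mu>). d (fst p) (snd p) < r} \<in> sets (\<mu> \<Otimes>\<^sub>M \<mu>)" for r
  proof -
    have "{p \<in> space (\<mu> \<Otimes>\<^sub>M \<mu>). d (fst p) (snd p) < r}
        = (\<Union>c\<in>C. \<Union>q\<in>\<rat>. mball c q \<times> mball c (r - q))" (is "?L = ?R")
    proof (intro set_eqI iffI)
      fix p assume p: "p \<in> ?L"
      obtain x y where xy: "p = (x, y)" by (cases p)
      with p have S: "x \<in> S" "y \<in> S" and lt: "d x y < r"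
        by (auto simp: space_pair_measure space_eq)
      define e where "e = (r - d x y) / 2"
      have e: "e > 0" using lt by (simp add: e_def)
      obtain c where c: "c \<in> C" "d c x < e" using dense[OF S(1) e] by blast
      obtain q where q: "q \<in> \<rat>" "d c x < q" "q < e" using Rats_dense_in_real[OF c(2)] by blast
      have cS: "c \<in> S" using c C by blast
      have "d c y \<le> d c x + d x y" using triangle cS S by blast
      then have "d c y < r - q" using c(2) q(3) by (simp add: e_def field_simps)
      then have "p \<in> mball c q \<times> mball c (r - q)" using xy q cS S by auto
      then show "p \<in> ?R" using c(1) q(1) by blast
    next
      fix p assume "p \<in> ?R"
      then obtain c q x y where *: "p = (x, y)" "c \<in> S" "x \<in> S" "y \<in> S" "d c x < q" "d c y < r - q"
        by auto
      have "d x y \<le> d c x + d c y" using triangle[of x c y] * commute[of x c] by simp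
      then show "p \<in> ?L" using * by (simp add: space_pair_measure space_eq)
    qed
    also have "\<dots> \<in> sets (\<mu> \<Otimes>\<^sub>M \<mu>)"
      by (intro sets.countable_UN'' C countable_rat pair_measureI mball_sets)
    finally show ?thesis .
  qed
  then show ?thesis by (rule borel_measurable_iff_less[THEN iffD2, rule_format])
qed

text \<open>The law of the distance between two independent points with distribution \<open>\<mu>\<close> does not
  depend on the underlying probability space.\<close>

lemma prob_dist_le_eq:
  fixes N :: "'w measure"
  assumes "prob_space N" and indep: "prob_space.indep_var N \<mu> X \<mu> Y"
    and X: "distr N \<mu> X = \<mu>" and Y: "distr N \<mu> Y = \<mu>"
  shows "\<P>(\<omega> in N. d (X \<omega>) (Y \<omega>) \<le> \<epsilon>) = \<P>(p in \<mu> \<Otimes>\<^sub>M \<mu>. d (fst p) (snd p) \<le> \<epsilon>)"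
proof -
  interpret N: prob_space N by fact
  have m: "X \<in> measurable N \<mu>" "Y \<in> measurable N \<mu>"
    and eq: "\<mu> \<Otimes>\<^sub>M \<mu> = distr N (\<mu> \<Otimes>\<^sub>M \<mu>) (\<lambda>\<omega>. (X \<omega>, Y \<omega>))"
    using indep X Y unfolding N.indep_var_distribution_eq by auto
  let ?A = "{p \<in> space (\<mu> \<Otimes>\<^sub>M \<mu>). d (fst p) (snd p) \<le> \<epsilon>}"
  have "?A \<in> sets (\<mu> \<Otimes>\<^sub>M \<mu>)" using measurable_dist by measurable
  then have "measure (distr N (\<mu> \<Otimes>\<^sub>M \<mu>) (\<lambda>\<omega>. (X \<omega>, Y \<omega>))) ?A
      = measure N ((\<lambda>\<omega>. (X \<omega>, Y \<omega>)) -` ?A \<inter> space N)"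
    using m by (intro measure_distr) auto
  also have "(\<lambda>\<omega>. (X \<omega>, Y \<omega>)) -` ?A \<inter> space N = {\<omega> \<in> space N. d (X \<omega>) (Y \<omega>) \<le> \<epsilon>}"
    using m[THEN measurable_space] by (auto simp: space_pair_measure)
  finally show ?thesis using eq by simp
qed

lemma coordinates_iid:
  "prob_space (\<mu> \<Otimes>\<^sub>M \<mu>)"
  "prob_space.indep_var (\<mu> \<Otimes>\<^sub>M \<mu>) \<mu> fst \<mu> snd"
  "distr (\<mu> \<Otimes>\<^sub>M \<mu>) \<mu> fst = \<mu>"
  "distr (\<mu> \<Otimes>\<^sub>M \<mu>) \<mu> snd = \<mu>"
proof -
  interpret P: pair_prob_space \<mu> \<mu> ..
  show ps: "prob_space (\<mu> \<Otimes>\<^sub>M \<mu>)" by (rule P.prob_space_axioms)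
  show f: "distr (\<mu> \<Otimes>\<^sub>M \<mu>) \<mu> fst = \<mu>"
    by (rule distr_pair_fst)
  have "distr (\<mu> \<Otimes>\<^sub>M \<mu>) \<mu> snd = distr (distr (\<mu> \<Otimes>\<^sub>M \<mu>) (\<mu> \<Otimes>\<^sub>M \<mu>) (\<lambda>(x, y). (y, x))) \<mu> fst"
    by (subst distr_distr) (auto simp: comp_def split_beta intro!: distr_cong)
  also have "\<dots> = \<mu>" using P.distr_pair_swap f by simp
  finally show s: "distr (\<mu> \<Otimes>\<^sub>M \<mu>) \<mu> snd = \<mu>" .
  show "prob_space.indep_var (\<mu> \<Otimes>\<^sub>M \<mu>) \<mu> fst \<mu> snd"
    unfolding prob_space.indep_var_distribution_eq[OF ps] f s
    using distr_id[of "\<mu> \<Otimes>\<^sub>M \<mu>"] by (simp add: id_def)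
qed

end

end

theory Submission
  imports Defs
begin

text \<open>
  Snowflaking the unit interval: the uniform distribution on \<open>[0,1]\<close> is kept, but the Euclidean
  distance is replaced by \<open>g \<bar>x - y\<bar>\<close> for a gauge \<open>g\<close> that tends to \<open>0\<close> at \<open>0\<close>, yet as slowly
  as desired. A subadditive gauge gives a metric with the Euclidean topology, so compactness and the
  Borel sets are those of \<open>[0,1]\<close> (\<open>mtopology_gauge\<close>). Two independent uniform points are within Euclidean distance
  \<open>r\<close> with probability at most \<open>2 * r\<close> (\<open>prob_uniform_unit_close\<close>); it therefore suffices to find \<open>g\<close> for which
  \<open>g t \<le> \<epsilon>\<close> forces \<open>t \<le> 2 * \<epsilon> * F \<epsilon>\<close>, as then \<open>P (D \<le> \<epsilon>) \<le> 4 * \<epsilon> * F \<epsilon> \<le> F \<epsilon>\<close> for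
  \<open>\<epsilon> \<le> 1/4\<close>.

  The gauge is the infimum of the increasing affine functions \<open>2 * a + t / F a\<close> over \<open>a > 0\<close>.
  It is concave, hence subadditive, and it tends to \<open>0\<close> at \<open>0\<close> because \<open>F a > 0\<close> for every \<open>a\<close>.
  If \<open>g t \<le> \<epsilon>\<close>, then one of these functions is below \<open>2 * \<epsilon>\<close> at \<open>t\<close>, so \<open>a < \<epsilon>\<close>, and the
  monotonicity of \<open>F\<close> gives \<open>t < 2 * \<epsilon> * F a \<le> 2 * \<epsilon> * F \<epsilon>\<close> (\<open>slow_gauge_le_imp\<close>).
\<close>

section \<open>Metrics obtained from a gauge\<close>

locale gauge =
  fixes g :: "real \<Rightarrow> real"
  assumes at_zero: "g 0 = 0"
    and pos: "0 < t \<Longrightarrow> 0 < g t"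
    and mono: "0 \<le> s \<Longrightarrow> s \<le> t \<Longrightarrow> g s \<le> g t"
    and subadd: "0 \<le> s \<Longrightarrow> 0 \<le> t \<Longrightarrow> g (s + t) \<le> g s + g t"
    and tendsto_zero: "(g \<longlongrightarrow> 0) (at_right 0)"
begin

lemma Metric_space_gauge: "Metric_space S (\<lambda>x y. g (dist x y))"
  for S :: "'a::metric_space set"
proof
  fix x y z :: 'a
  show "0 \<le> g (dist x y)"
    using at_zero pos[of "dist x y"] by (cases "x = y") auto
  show "g (dist x y) = g (dist y x)"
    by (simp add: dist_commute)
  show "g (dist x y) = 0 \<longleftrightarrow> x = y"
    using at_zero pos[of "dist x y"] by (cases "x = y") auto
  have "g (dist x z) \<le> g (dist x y + dist y z)"
    by (intro mono dist_triangle) auto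
  also have "\<dots> \<le> g (dist x y) + g (dist y z)"
    by (intro subadd) auto
  finally show "g (dist x z) \<le> g (dist x y) + g (dist y z)" .
qed

text \<open>Each ball of either metric contains a ball of the other one with the same centre: one
  inclusion is the monotonicity of \<open>g\<close>, the other one its continuity at \<open>0\<close>.\<close>

lemma mtopology_gauge:
  "Metric_space.mtopology S (\<lambda>x y. g (dist x y)) = top_of_set S"
  for S :: "'a::metric_space set"
proof -
  interpret Metric_space S "\<lambda>x y. g (dist x y)"
    by (rule Metric_space_gauge)
  have "openin mtopology U \<longleftrightarrow> openin (top_of_set S) U" for U
  proof
    assume U: "openin mtopology U"
    show "openin (top_of_set S) U"
      unfolding openin_euclidean_subtopology_iff
    proof (intro conjI ballI)
      show "U \<subseteq> S"
        using U by (simp add: openin_mtopology)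
      fix x assume x: "x \<in> U"
      then obtain r where r: "r > 0" "mball x r \<subseteq> U"
        using U unfolding openin_mtopology by blast
      have "\<forall>\<^sub>F t in at_right 0. g t < r"
        using tendsto_zero r(1) by (rule order_tendstoD)
      then obtain e where e: "e > 0" "\<And>t. 0 < t \<Longrightarrow> t < e \<Longrightarrow> g t < r"
        unfolding eventually_at_right_field by auto
      have "y \<in> U" if "y \<in> S" "dist y x < e" for y
      proof -
        have "g (dist x y) < r"
          using e(2)[of "dist x y"] that r(1) at_zero
          by (cases "x = y") (auto simp: dist_commute)
        then have "y \<in> mball x r"
          using that(1) x \<open>U \<subseteq> S\<close> by auto
        then show ?thesis
          using r(2) by blast
      qed
      then show "\<exists>e>0. \<forall>y\<in>S. dist y x < e \<longrightarrow> y \<in> U"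
        using e(1) by blast
    qed
  next
    assume U: "openin (top_of_set S) U"
    show "openin mtopology U"
      unfolding openin_mtopology
    proof (intro conjI allI impI)
      show "U \<subseteq> S"
        using U by (simp add: openin_euclidean_subtopology_iff)
      fix x assume "x \<in> U"
      then obtain e where e: "e > 0" "\<And>y. y \<in> S \<Longrightarrow> dist y x < e \<Longrightarrow> y \<in> U"
        using U unfolding openin_euclidean_subtopology_iff by blast
      have "mball x (g e) \<subseteq> U"
      proof
        fix y assume "y \<in> mball x (g e)"
        then have y: "y \<in> S" "g (dist x y) < g e"
          by auto
        then have "dist x y < e"
          using mono[of e "dist x y"] e(1) by linarith
        then show "y \<in> U"
          using e(2) y(1) by (simp add: dist_commute)
      qed
      then show "\<exists>r>0. mball x r \<subseteq> U"
        using pos e(1) by blast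
    qed
  qed
  then show ?thesis
    by (simp add: topology_eq)
qed

end

section \<open>A gauge of prescribed slowness\<close>

definition slow_gauge :: "(real \<Rightarrow> real) \<Rightarrow> real \<Rightarrow> real" where
  "slow_gauge F t = (INF a\<in>{0<..}. 2 * a + t / F a)"

context
  fixes F :: "real \<Rightarrow> real"
  assumes F_mono: "mono_on {0<..} F"
    and F_pos: "\<And>x. 0 < x \<Longrightarrow> 0 < F x"
begin

lemma slow_gauge_le:
  assumes "0 \<le> t" "0 < a"
  shows "slow_gauge F t \<le> 2 * a + t / F a"
  unfolding slow_gauge_def
proof (rule cINF_lower)
  show "bdd_below ((\<lambda>a. 2 * a + t / F a) ` {0<..})"
    by (rule bdd_belowI2[of _ 0]) (use assms F_pos in \<open>auto simp: less_imp_le\<close>)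
qed (use assms in simp)

lemma slow_gauge_greatest:
  assumes "\<And>a. 0 < a \<Longrightarrow> m \<le> 2 * a + t / F a"
  shows "m \<le> slow_gauge F t"
  unfolding slow_gauge_def by (rule cINF_greatest) (use assms in auto)

lemma slow_gauge_witness:
  assumes "slow_gauge F t < m"
  obtains a where "0 < a" "2 * a + t / F a < m"
  using slow_gauge_greatest[of m t] assms by (meson not_le)

text \<open>The factor \<open>2\<close> in front of \<open>a\<close> leaves room for the infimum not being attained: the
  conclusion involves \<open>F\<close> at \<open>\<epsilon>\<close> itself, although \<open>F\<close> may jump to the right of \<open>\<epsilon>\<close>.\<close>

lemma slow_gauge_le_imp:
  assumes "0 \<le> t" "0 < \<epsilon>" "slow_gauge F t \<le> \<epsilon>"
  shows "t < 2 * \<epsilon> * F \<epsilon>"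
proof -
  obtain a where a: "0 < a" "2 * a + t / F a < 2 * \<epsilon>"
    using slow_gauge_witness[of t "2 * \<epsilon>"] assms by auto
  have "0 \<le> t / F a"
    using assms(1) F_pos[OF a(1)] by simp
  then have "a \<le> \<epsilon>"
    using a by linarith
  then have "F a \<le> F \<epsilon>"
    using mono_onD[OF F_mono] a(1) by auto
  have "t / F a < 2 * \<epsilon>"
    using a by linarith
  then have "t < 2 * \<epsilon> * F a"
    using F_pos[OF a(1)] by (simp add: field_simps)
  also have "\<dots> \<le> 2 * \<epsilon> * F \<epsilon>"
    using \<open>F a \<le> F \<epsilon>\<close> assms(2) by simp
  finally show ?thesis .
qed

lemma gauge_slow_gauge: "gauge (slow_gauge F)"
proof
  have nonneg: "0 \<le> slow_gauge F t" if "0 \<le> t" for t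
    by (rule slow_gauge_greatest) (use that F_pos in \<open>auto simp: less_imp_le\<close>)
  show "slow_gauge F 0 = 0"
  proof (rule antisym)
    show "slow_gauge F 0 \<le> 0"
    proof (rule field_le_epsilon)
      show "slow_gauge F 0 \<le> 0 + e" if "0 < e" for e
        using slow_gauge_le[of 0 "e / 2"] that by simp
    qed
  qed (use nonneg in simp)
  show "0 < slow_gauge F t" if t: "0 < t" for t
  proof (rule ccontr)
    assume "\<not> 0 < slow_gauge F t"
    \<comment> \<open>The value is then below every positive \<open>\<epsilon>\<close>; it remains to choose \<open>\<epsilon>\<close> so small that
      \<open>2 * \<epsilon> * F \<epsilon> \<le> 2 * \<epsilon> * F 1 \<le> t\<close>.\<close>
    define \<epsilon> where "\<epsilon> = min 1 (t / (2 * F 1))"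
    have \<epsilon>: "0 < \<epsilon>" "\<epsilon> \<le> 1" "\<epsilon> \<le> t / (2 * F 1)"
      using t F_pos[of 1] by (auto simp: \<epsilon>_def)
    have "F \<epsilon> \<le> F 1"
      using mono_onD[OF F_mono] \<epsilon> by auto
    have "t < 2 * \<epsilon> * F \<epsilon>"
      using slow_gauge_le_imp[of t \<epsilon>] \<open>\<not> 0 < slow_gauge F t\<close> t \<epsilon>(1) by auto
    also have "\<dots> \<le> 2 * \<epsilon> * F 1"
      using \<open>F \<epsilon> \<le> F 1\<close> \<epsilon>(1) by simp
    also have "\<dots> \<le> t"
      using \<epsilon>(3) F_pos[of 1] by (simp add: field_simps)
    finally show False by simp
  qed
  show "slow_gauge F s \<le> slow_gauge F t" if "0 \<le> s" "s \<le> t" for s t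
  proof (rule slow_gauge_greatest)
    fix a :: real assume a: "0 < a"
    have "slow_gauge F s \<le> 2 * a + s / F a"
      using slow_gauge_le that a by simp
    also have "\<dots> \<le> 2 * a + t / F a"
      using that F_pos[OF a] by (simp add: divide_right_mono)
    finally show "slow_gauge F s \<le> 2 * a + t / F a" .
  qed
  show "slow_gauge F (s + t) \<le> slow_gauge F s + slow_gauge F t" if st: "0 \<le> s" "0 \<le> t" for s t
  proof -
    \<comment> \<open>Of two affine functions \<open>2 * a + _ / F a\<close> and \<open>2 * b + _ / F b\<close>, the one with the smaller
      slope, evaluated at \<open>s + t\<close>, is bounded by the sum of their values at \<open>s\<close> and at \<open>t\<close>.\<close>
    have affine: "slow_gauge F (s + t) \<le> (2 * a + s / F a) + (2 * b + t / F b)"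
      if ab: "0 < a" "0 < b" for a b
    proof (cases "F b \<le> F a")
      case True
      have "slow_gauge F (s + t) \<le> 2 * a + (s + t) / F a"
        using slow_gauge_le st ab by simp
      moreover have "t / F a \<le> t / F b"
        using True st F_pos[OF ab(1)] F_pos[OF ab(2)] by (intro divide_left_mono) auto
      ultimately show ?thesis
        using ab by (simp add: add_divide_distrib)
    next
      case False
      have "slow_gauge F (s + t) \<le> 2 * b + (s + t) / F b"
        using slow_gauge_le st ab by simp
      moreover have "s / F b \<le> s / F a"
        using False st F_pos[OF ab(1)] F_pos[OF ab(2)] by (intro divide_left_mono) auto
      ultimately show ?thesis
        using ab by (simp add: add_divide_distrib)
    qed
    have "slow_gauge F (s + t) - (2 * a + s / F a) \<le> slow_gauge F t" if "0 < a" for a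
    proof (rule slow_gauge_greatest)
      fix b :: real assume "0 < b"
      with affine[OF that this]
      show "slow_gauge F (s + t) - (2 * a + s / F a) \<le> 2 * b + t / F b"
        by linarith
    qed
    then have "slow_gauge F (s + t) - slow_gauge F t \<le> slow_gauge F s"
      by (intro slow_gauge_greatest) (auto simp: algebra_simps)
    then show ?thesis by simp
  qed
  show "(slow_gauge F \<longlongrightarrow> 0) (at_right 0)"
  proof (rule order_tendstoI)
    fix m :: real assume "m < 0"
    then show "\<forall>\<^sub>F t in at_right 0. m < slow_gauge F t"
      unfolding eventually_at_right_field
      by (intro exI[of _ 1]) (auto intro!: less_le_trans[OF _ nonneg])
  next
    fix m :: real assume m: "0 < m"
    \<comment> \<open>Split \<open>m\<close> evenly between the two summands of \<open>2 * a + t / F a\<close>, with \<open>a = m / 4\<close>.\<close>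
    have "slow_gauge F t < m" if t: "0 < t" "t < m / 2 * F (m / 4)" for t
    proof -
      have "slow_gauge F t \<le> 2 * (m / 4) + t / F (m / 4)"
        by (rule slow_gauge_le) (use t m in auto)
      also have "t / F (m / 4) < m / 2"
        using t F_pos[of "m / 4"] m by (simp add: pos_divide_less_eq)
      finally show ?thesis by simp
    qed
    moreover have "0 < m / 2 * F (m / 4)"
      using m F_pos[of "m / 4"] by simp
    ultimately show "\<forall>\<^sub>F t in at_right 0. slow_gauge F t < m"
      unfolding eventually_at_right_field by blast
  qed
qed

end

section \<open>Independent uniform points of the unit interval\<close>

abbreviation uniform_unit :: "real measure" where
  "uniform_unit \<equiv> restrict_space lborel {0..1}"

lemma prob_space_uniform_unit: "prob_space uniform_unit"
  by (rule prob_spaceI) (simp add: emeasure_restrict_space space_restrict_space)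

lemma sets_uniform_unit:
  "sets uniform_unit = sigma_sets {0..1} {U. openin (top_of_set {0..1}) U}"
proof -
  have "sets uniform_unit = sets (restrict_space borel {0..1})"
    by (rule sets_restrict_space_cong) simp
  also have "\<dots> = (\<inter>) {0..1} ` sigma_sets UNIV {U. open U}"
    by (simp add: sets_restrict_space borel_def)
  also have "\<dots> = sigma_sets {0..1} ((\<inter>) {0..1} ` {U. open U})"
    using sigma_sets_Int[of "{0..1::real}" UNIV "{U. open U}"]
    by (simp add: image_def Int_commute sets_borel[symmetric])
  also have "(\<inter>) {0..1} ` {U. open U} = {U. openin (top_of_set {0..1::real}) U}"
    by (auto simp: openin_open)
  finally show ?thesis .
qed

lemma compact_measured_metric_space_gauge:
  assumes "gauge g"
  shows "compact_measured_metric_space {0..1} (\<lambda>x y. g (dist x y)) uniform_unit"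
proof -
  interpret gauge g by fact
  interpret Metric_space "{0..1::real}" "\<lambda>x y. g (dist x y)"
    by (rule Metric_space_gauge)
  interpret prob_space uniform_unit
    by (rule prob_space_uniform_unit)
  show ?thesis
    by unfold_locales
      (simp_all add: mtopology_gauge sets_uniform_unit compact_space_subtopology space_restrict_space)
qed

text \<open>Given the first point, the second one must fall into an interval of length \<open>2 * r\<close>.\<close>

lemma prob_uniform_unit_close:
  assumes A: "A \<in> sets (uniform_unit \<Otimes>\<^sub>M uniform_unit)"
    and close: "\<And>p. p \<in> A \<Longrightarrow> dist (fst p) (snd p) \<le> r"
    and "0 \<le> r"
  shows "measure (uniform_unit \<Otimes>\<^sub>M uniform_unit) A \<le> 2 * r"
proof -
  interpret prob_space uniform_unit
    by (rule prob_space_uniform_unit)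
  have slice: "emeasure uniform_unit (Pair x -` A) \<le> ennreal (2 * r)" for x
  proof -
    have "Pair x -` A \<in> sets uniform_unit"
      using A by (rule sets_Pair1)
    then have "Pair x -` A \<subseteq> {0..1}"
      by (auto dest!: sets.sets_into_space simp: space_restrict_space)
    then have "emeasure uniform_unit (Pair x -` A) = emeasure lborel (Pair x -` A)"
      by (simp add: emeasure_restrict_space)
    also have "\<dots> \<le> emeasure lborel {x - r..x + r}"
      by (rule emeasure_mono) (use close in \<open>force simp: dist_real_def abs_le_iff\<close>)+
    also have "\<dots> = ennreal (2 * r)"
      using \<open>0 \<le> r\<close> by simp
    finally show ?thesis .
  qed
  have "emeasure (uniform_unit \<Otimes>\<^sub>M uniform_unit) A
      = (\<integral>\<^sup>+ x. emeasure uniform_unit (Pair x -` A) \<partial>uniform_unit)"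
    using A by (rule emeasure_pair_measure_alt)
  also have "\<dots> \<le> (\<integral>\<^sup>+ x. ennreal (2 * r) \<partial>uniform_unit)"
    by (intro nn_integral_mono slice)
  also have "\<dots> = ennreal (2 * r)"
    using emeasure_space_1 by (simp only: nn_integral_const mult_1_right)
  finally show ?thesis
    using \<open>0 \<le> r\<close> by (simp add: measure_def enn2real_leI)
qed

theorem proposition2:
  fixes F :: "real \<Rightarrow> real"
  assumes "mono_on {0<..} F"
    and "\<And>x. x > 0 \<Longrightarrow> F x \<in> {0<..1}"
  shows "\<exists>(S :: real set) d \<mu>. compact_measured_metric_space S d \<mu> \<and>
    (\<forall>(N :: 'w measure) \<xi>1 \<xi>2.
       prob_space N \<and> prob_space.indep_var N \<mu> \<xi>1 \<mu> \<xi>2 \<and>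
       distr N \<mu> \<xi>1 = \<mu> \<and> distr N \<mu> \<xi>2 = \<mu> \<longrightarrow>
       (\<forall>\<^sub>F \<epsilon> in at_right 0. \<P>(\<omega> in N. d (\<xi>1 \<omega>) (\<xi>2 \<omega>) \<le> \<epsilon>) \<le> F \<epsilon>))"
proof -
  have F_pos: "0 < F x" if "0 < x" for x
    using assms(2)[OF that] by simp
  define d where "d = (\<lambda>x y :: real. slow_gauge F (dist x y))"
  interpret compact_measured_metric_space "{0..1}" d uniform_unit
    unfolding d_def
    by (intro compact_measured_metric_space_gauge gauge_slow_gauge assms(1) F_pos)
  have "\<P>(\<omega> in N. d (X \<omega>) (Y \<omega>) \<le> \<epsilon>) \<le> F \<epsilon>"
    if XY: "prob_space N" "prob_space.indep_var N uniform_unit X uniform_unit Y"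
      "distr N uniform_unit X = uniform_unit" "distr N uniform_unit Y = uniform_unit"
      and \<epsilon>: "0 < \<epsilon>" "\<epsilon> < 1 / 4"
    for N :: "'w measure" and X Y \<epsilon>
  proof -
    let ?A = "{p \<in> space (uniform_unit \<Otimes>\<^sub>M uniform_unit). d (fst p) (snd p) \<le> \<epsilon>}"
    have "\<P>(\<omega> in N. d (X \<omega>) (Y \<omega>) \<le> \<epsilon>) = measure (uniform_unit \<Otimes>\<^sub>M uniform_unit) ?A"
      using XY by (rule prob_dist_le_eq)
    also have "\<dots> \<le> 2 * (2 * \<epsilon> * F \<epsilon>)"
    proof (rule prob_uniform_unit_close)
      show "?A \<in> sets (uniform_unit \<Otimes>\<^sub>M uniform_unit)"
        using measurable_dist by measurable
      show "dist (fst p) (snd p) \<le> 2 * \<epsilon> * F \<epsilon>" if "p \<in> ?A" for p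
        using slow_gauge_le_imp[OF assms(1) F_pos, of "dist (fst p) (snd p)" \<epsilon>] that \<epsilon>(1)
        by (simp add: d_def)
      show "0 \<le> 2 * \<epsilon> * F \<epsilon>"
        using \<epsilon>(1) F_pos[OF \<epsilon>(1)] by simp
    qed
    also have "\<dots> = (4 * \<epsilon>) * F \<epsilon>"
      by simp
    also have "\<dots> \<le> F \<epsilon>"
      using \<epsilon> F_pos[OF \<epsilon>(1)] by (intro mult_left_le_one_le) auto
    finally show ?thesis .
  qed
  then have "\<forall>\<^sub>F \<epsilon> in at_right 0. \<P>(\<omega> in N. d (X \<omega>) (Y \<omega>) \<le> \<epsilon>) \<le> F \<epsilon>"
    if "prob_space N" "prob_space.indep_var N uniform_unit X uniform_unit Y"
      "distr N uniform_unit X = uniform_unit" "distr N uniform_unit Y = uniform_unit"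
    for N :: "'w measure" and X Y
    using that by (intro eventually_at_rightI[of 0 "1 / 4"]) auto
  then show ?thesis
    using compact_measured_metric_space_axioms
    by (intro exI[of _ "{0..1}"] exI[of _ d] exI[of _ uniform_unit]) simp
qed

end
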